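(* Let $\mathcal{V}$ be a strongly irregular variety of a plural type (possibly with constants), let $\mathbf{A}$ be the P\l onka sum over a semilattice direct system $\mathbb{A}=(\{\mathbf{A}_i\}_{i\in I},(I,\le),\{p_{ij}\}_{i\le j})$ of algebras in $\mathcal{V}$, and let $\theta_1,\theta_2\in Con(\mathbf{A})$. Then the following are equivalent: (1) $(\theta_1,\theta_2)$ is a pair of factor congruences on $\mathbf{A}$; (2) $\theta_1,\theta_2$ are permutable, $(C_{\theta_1},C_{\theta_2})$ is a pair of factor congruences on $\mathbf{I}=(I,\le)$, and for every $i\in I$, $((\theta_1)_{ii},(\theta_2)_{ii})$ is a pair of factor congruences on $\mathbf{A}_i$.
   Context: A type is plural if it contains at least one operation symbol of arity at least $2$. A variety $\mathcal{V}$ is strongly irregular if there is a binary term $f(x,y)$, in which both variables actually occur, such that $\mathcal{V}\models f(x,y)\approx x$. A semilattice direct system $\mathbb{A}=(\{\mathbf{A}_i\}_{i\in I},(I,\le),\{p_{ij}\}_{i\le j})$ consists of a join-semilattice $\mathbf{I}=(I,\le)$ with join $\vee$ (required to have a least element $i_0$ when the type contains constants), algebras $\mathbf{A}_i$ of the same type with pairwise disjoint universes, and homomorphisms $p_{ij}\colon\mathbf{A}_i\to\mathbf{A}_j$ for $i\le j$ with $p_{ii}=\mathrm{id}$ and $p_{ik}=p_{jk}\circ p_{ij}$ for $i\le j\le k$. Its P\l onka sum is the algebra with universe $\bigcup_{i\in I}A_i$ in which, for every $n$-ary operation $g$ with $n\ge1$ and $a_1\in A_{i_1},\dots,a_n\in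 A_{i_n}$, $g(a_1,\dots,a_n)=g^{\mathbf{A}_j}(p_{i_1j}(a_1),\dots,p_{i_nj}(a_n))$ with $j=i_1\vee\dots\vee i_n$, and every constant $c$ is interpreted as $c^{\mathbf{A}_{i_0}}$. For $\theta\in Con(\mathbf{A})$: $\theta_{ij}:=\theta\cap(A_i\times A_j)$; $S_\theta:=\{(i,j)\in I\times I\mid\theta_{ij}\neq\emptyset\}$; $C_\theta:=\{(i,j)\in I\times I\mid (i,i\vee j),(j,i\vee j)\in S_\theta\}$, which is a congruence of $\mathbf{I}$. Congruences $\theta_1,\theta_2$ of an algebra are permutable if $\theta_1\circ\theta_2=\theta_2\circ\theta_1$ (relational product). A pair $(\theta_1,\theta_2)$ of congruences of an algebra $\mathbf{B}$ is a pair of factor congruences if $\theta_1\cap\theta_2=\Delta_{\mathbf{B}}$ (identity relation), $\theta_1\vee\theta_2=\nabla_{\mathbf{B}}$ (total relation) and $\theta_1,\theta_2$ are permutable. *)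

theory Defs
  imports "HOL-Algebra.Lattice"
begin

text \<open>
  A type of algebras is given by an arity function \<^term>\<open>ar :: 'f \<Rightarrow> nat\<close> on a HOL type of
  operation symbols; constants are the symbols of arity 0. An operation is applied to the list
  of its arguments, and its value matters only on lists of length \<^term>\<open>ar g\<close> over the carrier.
\<close>

record ('a, 'f) algebra = "'a partial_object" +
  opn :: "'f \<Rightarrow> 'a list \<Rightarrow> 'a"

definition is_algebra :: "('f \<Rightarrow> nat) \<Rightarrow> ('a, 'f) algebra \<Rightarrow> bool" where
  "is_algebra ar A \<longleftrightarrow> carrier A \<noteq> {} \<and>
     (\<forall>g xs. length xs = ar g \<and> set xs \<subseteq> carrier A \<longrightarrow> opn A g xs \<in> carrier A)"

definition is_hom ::
  "('f \<Rightarrow> nat) \<Rightarrow> ('a, 'f) algebra \<Rightarrow> ('b, 'f) algebra \<Rightarrow> ('a \<Rightarrow> 'b) \<Rightarrow> bool" where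
  "is_hom ar A B h \<longleftrightarrow> h ` carrier A \<subseteq> carrier B \<and>
     (\<forall>g xs. length xs = ar g \<and> set xs \<subseteq> carrier A \<longrightarrow> h (opn A g xs) = opn B g (map h xs))"

definition plural :: "('f \<Rightarrow> nat) \<Rightarrow> bool" where
  "plural ar \<longleftrightarrow> (\<exists>g. ar g \<ge> 2)"

datatype (syms_trm: 'f, vars_trm: 'v) trm = Var 'v | App 'f "('f, 'v) trm list"

primrec wf_trm :: "('f \<Rightarrow> nat) \<Rightarrow> ('f, 'v) trm \<Rightarrow> bool" where
  "wf_trm ar (Var x) \<longleftrightarrow> True"
| "wf_trm ar (App g ts) \<longleftrightarrow> length ts = ar g \<and> list_all (wf_trm ar) ts"

primrec eval_trm :: "('a, 'f) algebra \<Rightarrow> ('v \<Rightarrow> 'a) \<Rightarrow> ('f, 'v) trm \<Rightarrow> 'a" where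
  "eval_trm A \<rho> (Var x) = \<rho> x"
| "eval_trm A \<rho> (App g ts) = opn A g (map (eval_trm A \<rho>) ts)"

definition satisfies :: "('a, 'f) algebra \<Rightarrow> ('f, 'v) trm \<times> ('f, 'v) trm \<Rightarrow> bool" where
  "satisfies A e \<longleftrightarrow>
     (\<forall>\<rho>. range \<rho> \<subseteq> carrier A \<longrightarrow> eval_trm A \<rho> (fst e) = eval_trm A \<rho> (snd e))"

text \<open>
  A variety is an equational class: all algebras (with universe contained in the ambient type
  \<^typ>\<open>'a\<close>) satisfying some set of identities in countably many variables.
\<close>

definition variety :: "('f \<Rightarrow> nat) \<Rightarrow> ('a, 'f) algebra set \<Rightarrow> bool" where
  "variety ar V \<longleftrightarrow>
     (\<exists>E :: (('f, nat) trm \<times> ('f, nat) trm) set.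
        (\<forall>(s, t)\<in>E. wf_trm ar s \<and> wf_trm ar t) \<and>
        V = {A. is_algebra ar A \<and> (\<forall>e\<in>E. satisfies A e)})"

text \<open>The two variables \<open>x\<close> and \<open>y\<close> are \<^term>\<open>0 :: nat\<close> and \<^term>\<open>1 :: nat\<close>.\<close>

definition strongly_irregular :: "('f \<Rightarrow> nat) \<Rightarrow> ('a, 'f) algebra set \<Rightarrow> bool" where
  "strongly_irregular ar V \<longleftrightarrow>
     (\<exists>t :: ('f, nat) trm. wf_trm ar t \<and> vars_trm t = {0, 1} \<and>
        (\<forall>A\<in>V. satisfies A (t, Var 0)))"

definition is_congruence :: "('f \<Rightarrow> nat) \<Rightarrow> ('a, 'f) algebra \<Rightarrow> 'a rel \<Rightarrow> bool" where
  "is_congruence ar A \<theta> \<longleftrightarrow> equiv (carrier A) \<theta> \<and>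
     (\<forall>g xs ys. length xs = ar g \<and> list_all2 (\<lambda>x y. (x, y) \<in> \<theta>) xs ys \<longrightarrow>
        (opn A g xs, opn A g ys) \<in> \<theta>)"

definition permutable :: "'a rel \<Rightarrow> 'a rel \<Rightarrow> bool" where
  "permutable \<theta>1 \<theta>2 \<longleftrightarrow> \<theta>1 O \<theta>2 = \<theta>2 O \<theta>1"

definition congruence_join ::
  "('f \<Rightarrow> nat) \<Rightarrow> ('a, 'f) algebra \<Rightarrow> 'a rel \<Rightarrow> 'a rel \<Rightarrow> 'a rel" where
  "congruence_join ar A \<theta>1 \<theta>2 = \<Inter>{\<phi>. is_congruence ar A \<phi> \<and> \<theta>1 \<union> \<theta>2 \<subseteq> \<phi>}"

definition factor_congruences ::
  "('f \<Rightarrow> nat) \<Rightarrow> ('a, 'f) algebra \<Rightarrow> 'a rel \<Rightarrow> 'a rel \<Rightarrow> bool" where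
  "factor_congruences ar A \<theta>1 \<theta>2 \<longleftrightarrow>
     is_congruence ar A \<theta>1 \<and> is_congruence ar A \<theta>2 \<and>
     \<theta>1 \<inter> \<theta>2 = Id_on (carrier A) \<and>
     congruence_join ar A \<theta>1 \<theta>2 = carrier A \<times> carrier A \<and>
     permutable \<theta>1 \<theta>2"

definition semilattice_arity :: "unit \<Rightarrow> nat" where
  "semilattice_arity = (\<lambda>_. 2)"

definition semilattice_algebra :: "'i gorder \<Rightarrow> ('i, unit) algebra" where
  "semilattice_algebra I = \<lparr>carrier = carrier I, opn = (\<lambda>_ is. is ! 0 \<squnion>\<^bsub>I\<^esub> is ! 1)\<rparr>"

locale semilattice_direct_system =
  fixes ar :: "'f \<Rightarrow> nat"
    and I :: "'i gorder"
    and A :: "'i \<Rightarrow> ('a, 'f) algebra"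
    and p :: "'i \<Rightarrow> 'i \<Rightarrow> 'a \<Rightarrow> 'a"
  assumes semilattice: "upper_semilattice I"
    and index_nonempty: "carrier I \<noteq> {}"
    and least_index: "(\<exists>g. ar g = 0) \<Longrightarrow> \<exists>i0. least I i0 (carrier I)"
    and algebra: "i \<in> carrier I \<Longrightarrow> is_algebra ar (A i)"
    and disjoint:
      "\<lbrakk>i \<in> carrier I; j \<in> carrier I; i \<noteq> j\<rbrakk> \<Longrightarrow> carrier (A i) \<inter> carrier (A j) = {}"
    and hom:
      "\<lbrakk>i \<in> carrier I; j \<in> carrier I; i \<sqsubseteq>\<^bsub>I\<^esub> j\<rbrakk> \<Longrightarrow> is_hom ar (A i) (A j) (p i j)"
    and hom_id: "\<lbrakk>i \<in> carrier I; a \<in> carrier (A i)\<rbrakk> \<Longrightarrow> p i i a = a"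
    and hom_comp:
      "\<lbrakk>i \<in> carrier I; j \<in> carrier I; k \<in> carrier I; i \<sqsubseteq>\<^bsub>I\<^esub> j; j \<sqsubseteq>\<^bsub>I\<^esub> k; a \<in> carrier (A i)\<rbrakk>
        \<Longrightarrow> p i k a = p j k (p i j a)"

definition index_of :: "'i gorder \<Rightarrow> ('i \<Rightarrow> ('a, 'f) algebra) \<Rightarrow> 'a \<Rightarrow> 'i" where
  "index_of I A a = (THE i. i \<in> carrier I \<and> a \<in> carrier (A i))"

text \<open>
  For \<^term>\<open>xs\<close> of positive length, \<open>j\<close> below is the join of the indices of its members: a
  supremum of a nonempty finite set, which exists in a join-semilattice. Constants are
  interpreted in the component of the least index.
\<close>

definition plonka_sum ::
  "('f \<Rightarrow> nat) \<Rightarrow> 'i gorder \<Rightarrow> ('i \<Rightarrow> ('a, 'f) algebra) \<Rightarrow> ('i \<Rightarrow> 'i \<Rightarrow> 'a \<Rightarrow> 'a)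
    \<Rightarrow> ('a, 'f) algebra" where
  "plonka_sum ar I A p =
     \<lparr>carrier = (\<Union>i\<in>carrier I. carrier (A i)),
      opn = (\<lambda>g xs.
        if ar g = 0 then opn (A \<bottom>\<^bsub>I\<^esub>) g []
        else let j = \<Squnion>\<^bsub>I\<^esub> (index_of I A ` set xs)
             in opn (A j) g (map (\<lambda>a. p (index_of I A a) j a) xs))\<rparr>"

definition component :: "('i \<Rightarrow> ('a, 'f) algebra) \<Rightarrow> 'a rel \<Rightarrow> 'i \<Rightarrow> 'i \<Rightarrow> 'a rel" where
  "component A \<theta> i j = \<theta> \<inter> (carrier (A i) \<times> carrier (A j))"

definition S_rel :: "'i gorder \<Rightarrow> ('i \<Rightarrow> ('a, 'f) algebra) \<Rightarrow> 'a rel \<Rightarrow> 'i rel" where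
  "S_rel I A \<theta> = {(i, j) \<in> carrier I \<times> carrier I. component A \<theta> i j \<noteq> {}}"

definition C_rel :: "'i gorder \<Rightarrow> ('i \<Rightarrow> ('a, 'f) algebra) \<Rightarrow> 'a rel \<Rightarrow> 'i rel" where
  "C_rel I A \<theta> = {(i, j) \<in> carrier I \<times> carrier I.
     (i, i \<squnion>\<^bsub>I\<^esub> j) \<in> S_rel I A \<theta> \<and> (j, i \<squnion>\<^bsub>I\<^esub> j) \<in> S_rel I A \<theta>}"

end

theory Submission
  imports Defs
begin

text \<open>
  Evaluating the strong irregularity term in the Plonka sum yields the partition function
  \<open>a \<cdot> b = p\<^sub>i\<^sub>,\<^sub>i\<^sub>\<squnion>\<^sub>j a\<close> (with \<open>a \<in> A\<^sub>i\<close>, \<open>b \<in> A\<^sub>j\<close>), so every congruence is compatible with it. As \<open>a \<cdot> b\<close>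
  depends on \<open>b\<close> only through its index, the semilattice \<open>I\<close> acts on the sum, and \<open>C\<^sub>\<theta>\<close> turns out to
  be the kernel of this action modulo \<open>\<theta>\<close>: \<open>(i, j) \<in> C\<^sub>\<theta>\<close> iff the actions of \<open>i\<close> and \<open>j\<close> agree up to
  \<open>\<theta>\<close> on all elements. Both directions then follow by letting suitable indices act on a path
  \<open>a \<theta>\<^sub>1 c \<theta>\<^sub>2 b\<close>.
\<close>

section \<open>Congruences, their composites and factor pairs in an arbitrary algebra\<close>

lemma eval_trm_cong_congruence:
  assumes cong: "is_congruence ar B \<theta>" and rel: "\<And>v. (\<rho> v, \<sigma> v) \<in> \<theta>"
  shows "wf_trm ar t \<Longrightarrow> (eval_trm B \<rho> t, eval_trm B \<sigma> t) \<in> \<theta>"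
proof (induction t)
  case (Var x)
  show ?case using rel by simp
next
  case (App g ts)
  then have "list_all2 (\<lambda>x y. (x, y) \<in> \<theta>) (map (eval_trm B \<rho>) ts) (map (eval_trm B \<sigma>) ts)"
    by (auto simp: list_all2_conv_all_nth list_all_length)
  with App.prems show ?case
    using cong unfolding is_congruence_def by simp
qed

text \<open>Commutation rearranges \<open>(\<alpha> O \<beta>) O (\<alpha> O \<beta>)\<close> into
  \<open>(\<alpha> O \<alpha>) O (\<beta> O \<beta>)\<close>, which gives transitivity; symmetry is
  commutation read through converses.\<close>

lemma is_congruence_relcomp:
  assumes \<alpha>: "is_congruence ar B \<alpha>" and \<beta>: "is_congruence ar B \<beta>" and perm: "permutable \<alpha> \<beta>"
  shows "is_congruence ar B (\<alpha> O \<beta>)"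
proof -
  have eq\<alpha>: "equiv (carrier B) \<alpha>" and eq\<beta>: "equiv (carrier B) \<beta>"
    using \<alpha> \<beta> by (auto simp: is_congruence_def)
  have comm: "\<alpha> O \<beta> = \<beta> O \<alpha>"
    using perm by (simp add: permutable_def)
  have conv: "\<alpha>\<inverse> = \<alpha>" "\<beta>\<inverse> = \<beta>" and idem: "\<alpha> O \<alpha> \<subseteq> \<alpha>" "\<beta> O \<beta> \<subseteq> \<beta>"
    using eq\<alpha> eq\<beta> by (auto simp: equiv_def sym_conv_converse_eq trans_O_subset)
  have "(\<alpha> O \<beta>)\<inverse> = \<alpha> O \<beta>"
    by (simp add: converse_relcomp conv comm)
  then have sym: "sym (\<alpha> O \<beta>)"
    by (simp add: sym_conv_converse_eq)
  have "(\<alpha> O \<beta>) O (\<alpha> O \<beta>) = (\<alpha> O \<alpha>) O (\<beta> O \<beta>)"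
    by (metis O_assoc comm)
  also have "\<dots> \<subseteq> \<alpha> O \<beta>"
    using idem by (rule relcomp_mono)
  finally have trans: "trans (\<alpha> O \<beta>)"
    by (auto simp: trans_def)
  have "equiv (carrier B) (\<alpha> O \<beta>)"
    using eq\<alpha> eq\<beta> sym trans by (fastforce simp: equiv_def refl_on_def)
  moreover have "(opn B g xs, opn B g ys) \<in> \<alpha> O \<beta>"
    if "length xs = ar g" "list_all2 (\<lambda>x y. (x, y) \<in> \<alpha> O \<beta>) xs ys" for g xs ys
  proof -
    \<comment> \<open>Intermediate elements are chosen entry by entry; the value of \<open>g\<close>
      on their list \<open>zs\<close> is then intermediate for the two results.\<close>
    have "\<forall>i<length xs. \<exists>z. (xs ! i, z) \<in> \<alpha> \<and> (z, ys ! i) \<in> \<beta>"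
      using that(2) by (auto simp: list_all2_conv_all_nth)
    then obtain z where z: "\<forall>i<length xs. (xs ! i, z i) \<in> \<alpha> \<and> (z i, ys ! i) \<in> \<beta>"
      by metis
    define zs where "zs = map z [0..<length xs]"
    have "list_all2 (\<lambda>x y. (x, y) \<in> \<alpha>) xs zs" "list_all2 (\<lambda>x y. (x, y) \<in> \<beta>) zs ys"
      using z that(2) by (auto simp: zs_def list_all2_conv_all_nth)
    moreover have "length zs = ar g"
      using that(1) by (simp add: zs_def)
    ultimately show ?thesis
      using \<alpha> \<beta> that(1) unfolding is_congruence_def by blast
  qed
  ultimately show ?thesis
    by (simp add: is_congruence_def)
qed

text \<open>By reflexivity the composite contains both congruences, and it is itself a congruence;
  by transitivity it lies inside every congruence containing both.\<close>

lemma congruence_join_permutable: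
  assumes \<alpha>: "is_congruence ar B \<alpha>" and \<beta>: "is_congruence ar B \<beta>" and perm: "permutable \<alpha> \<beta>"
  shows "congruence_join ar B \<alpha> \<beta> = \<alpha> O \<beta>"
proof
  have "equiv (carrier B) \<alpha>" "equiv (carrier B) \<beta>"
    using \<alpha> \<beta> by (auto simp: is_congruence_def)
  then have "\<alpha> \<union> \<beta> \<subseteq> \<alpha> O \<beta>"
    by (fastforce simp: equiv_def refl_on_def)
  then show "congruence_join ar B \<alpha> \<beta> \<subseteq> \<alpha> O \<beta>"
    using is_congruence_relcomp[OF assms] unfolding congruence_join_def by blast
  show "\<alpha> O \<beta> \<subseteq> congruence_join ar B \<alpha> \<beta>"
    unfolding congruence_join_def is_congruence_def equiv_def trans_def by blast
qed

lemma factor_congruences_iff: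
  "factor_congruences ar B \<alpha> \<beta> \<longleftrightarrow>
     is_congruence ar B \<alpha> \<and> is_congruence ar B \<beta> \<and> \<alpha> \<inter> \<beta> = Id_on (carrier B) \<and>
     \<alpha> O \<beta> = carrier B \<times> carrier B \<and> permutable \<alpha> \<beta>"
  unfolding factor_congruences_def using congruence_join_permutable by metis

text \<open>Permutability comes for free: the total relation equals its converse, and the converse
  of \<open>\<alpha> O \<beta>\<close> is \<open>\<beta> O \<alpha>\<close>.\<close>

lemma factor_congruencesI:
  assumes \<alpha>: "is_congruence ar B \<alpha>" and \<beta>: "is_congruence ar B \<beta>"
    and int: "\<And>a b. (a, b) \<in> \<alpha> \<Longrightarrow> (a, b) \<in> \<beta> \<Longrightarrow> a = b"
    and comp: "\<And>a b. a \<in> carrier B \<Longrightarrow> b \<in> carrier B \<Longrightarrow> (a, b) \<in> \<alpha> O \<beta>"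
  shows "factor_congruences ar B \<alpha> \<beta>"
proof -
  have eq: "equiv (carrier B) \<alpha>" "equiv (carrier B) \<beta>"
    using \<alpha> \<beta> by (auto simp: is_congruence_def)
  have total: "\<alpha> O \<beta> = carrier B \<times> carrier B"
    using eq comp by (auto simp: equiv_def)
  have "\<beta> O \<alpha> = (\<alpha> O \<beta>)\<inverse>"
    using eq by (simp add: converse_relcomp equiv_def sym_conv_converse_eq)
  then have "permutable \<alpha> \<beta>"
    by (auto simp: permutable_def total)
  moreover have "\<alpha> \<inter> \<beta> = Id_on (carrier B)"
    using eq int by (auto simp: equiv_def refl_on_def Id_on_def)
  ultimately show ?thesis
    using \<alpha> \<beta> total by (simp add: factor_congruences_iff)
qed

section \<open>The action of the index semilattice on the Plonka sum\<close>

context semilattice_direct_system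
begin

sublocale index: upper_semilattice I
  by (rule semilattice)

abbreviation P :: "('a, 'f) algebra" where
  "P \<equiv> plonka_sum ar I A p"

abbreviation ix :: "'a \<Rightarrow> 'i" where
  "ix \<equiv> index_of I A"

definition act :: "'i \<Rightarrow> 'a \<Rightarrow> 'a" where
  "act i a = p (ix a) (ix a \<squnion>\<^bsub>I\<^esub> i) a"

lemma join_assoc:
  "\<lbrakk>i \<in> carrier I; j \<in> carrier I; k \<in> carrier I\<rbrakk>
    \<Longrightarrow> (i \<squnion>\<^bsub>I\<^esub> j) \<squnion>\<^bsub>I\<^esub> k = i \<squnion>\<^bsub>I\<^esub> (j \<squnion>\<^bsub>I\<^esub> k)"
  using index.weak_join_assoc by (simp add: index.eq_is_equal)

lemma join_absorb: "\<lbrakk>i \<in> carrier I; j \<in> carrier I; j \<sqsubseteq>\<^bsub>I\<^esub> i\<rbrakk> \<Longrightarrow> i \<squnion>\<^bsub>I\<^esub> j = i"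
  by (meson index.join_closed index.join_le index.join_left index.le_antisym index.le_refl)

lemma join_idem: "i \<in> carrier I \<Longrightarrow> i \<squnion>\<^bsub>I\<^esub> i = i"
  by (simp add: join_absorb)

lemma Sup_singleton: "i \<in> carrier I \<Longrightarrow> \<Squnion>\<^bsub>I\<^esub>{i} = i"
  using index.weak_sup_of_singleton by (simp add: index.eq_is_equal)

lemma carrier_P: "carrier P = (\<Union>i\<in>carrier I. carrier (A i))"
  by (simp add: plonka_sum_def)

lemma component_subset_P: "\<lbrakk>i \<in> carrier I; a \<in> carrier (A i)\<rbrakk> \<Longrightarrow> a \<in> carrier P"
  by (auto simp: carrier_P)

lemma ix_eq: "\<lbrakk>i \<in> carrier I; a \<in> carrier (A i)\<rbrakk> \<Longrightarrow> ix a = i"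
  unfolding index_of_def using disjoint by blast

lemma ix_mem: "a \<in> carrier P \<Longrightarrow> ix a \<in> carrier I \<and> a \<in> carrier (A (ix a))"
  by (auto simp: carrier_P ix_eq)

lemma component_nonempty: "i \<in> carrier I \<Longrightarrow> \<exists>a. a \<in> carrier (A i)"
  using algebra[of i] by (auto simp: is_algebra_def)

lemma opn_closed:
  "\<lbrakk>i \<in> carrier I; length xs = ar g; set xs \<subseteq> carrier (A i)\<rbrakk> \<Longrightarrow> opn (A i) g xs \<in> carrier (A i)"
  using algebra by (auto simp: is_algebra_def)

lemma p_closed:
  "\<lbrakk>i \<in> carrier I; j \<in> carrier I; i \<sqsubseteq>\<^bsub>I\<^esub> j; a \<in> carrier (A i)\<rbrakk> \<Longrightarrow> p i j a \<in> carrier (A j)"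
  using hom by (auto simp: is_hom_def)

lemma p_opn:
  "\<lbrakk>i \<in> carrier I; j \<in> carrier I; i \<sqsubseteq>\<^bsub>I\<^esub> j; length xs = ar g; set xs \<subseteq> carrier (A i)\<rbrakk>
    \<Longrightarrow> p i j (opn (A i) g xs) = opn (A j) g (map (p i j) xs)"
  using hom by (auto simp: is_hom_def)

lemma act_mem_component:
  "\<lbrakk>i \<in> carrier I; a \<in> carrier P\<rbrakk> \<Longrightarrow> act i a \<in> carrier (A (ix a \<squnion>\<^bsub>I\<^esub> i))"
  unfolding act_def using ix_mem[of a] by (auto intro!: p_closed index.join_left)

lemma ix_act: "\<lbrakk>i \<in> carrier I; a \<in> carrier P\<rbrakk> \<Longrightarrow> ix (act i a) = ix a \<squnion>\<^bsub>I\<^esub> i"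
  by (intro ix_eq act_mem_component) (auto simp: ix_mem)

lemma act_closed: "\<lbrakk>i \<in> carrier I; a \<in> carrier P\<rbrakk> \<Longrightarrow> act i a \<in> carrier P"
  using component_subset_P[OF _ act_mem_component] ix_mem by simp

lemma act_ix: "a \<in> carrier P \<Longrightarrow> act (ix a) a = a"
  using ix_mem[of a] by (simp add: act_def join_idem hom_id)

text \<open>Transition maps compose along the chain from \<open>ix a\<close> through its join with
  \<open>i\<close> to the further join with \<open>j\<close>. With this, \<open>act\<close> is an
  action of the semilattice \<open>I\<close>.\<close>

lemma act_act:
  assumes "i \<in> carrier I" "j \<in> carrier I" "a \<in> carrier P"
  shows "act j (act i a) = act (i \<squnion>\<^bsub>I\<^esub> j) a"
proof -
  have "act j (act i a) = p (ix a \<squnion>\<^bsub>I\<^esub> i) (ix a \<squnion>\<^bsub>I\<^esub> i \<squnion>\<^bsub>I\<^esub> j) (p (ix a) (ix a \<squnion>\<^bsub>I\<^esub> i) a)"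
    using assms by (simp add: act_def[of j] ix_act) (simp add: act_def)
  also have "\<dots> = p (ix a) (ix a \<squnion>\<^bsub>I\<^esub> i \<squnion>\<^bsub>I\<^esub> j) a"
    using assms ix_mem[of a] by (intro hom_comp[symmetric]) (auto intro: index.join_left)
  finally show ?thesis
    using assms ix_mem[of a] by (simp add: act_def join_assoc)
qed

section \<open>Least index, finite joins, and evaluation of terms in the sum\<close>

lemma bottom_least:
  assumes "ar g = 0"
  shows "\<bottom>\<^bsub>I\<^esub> \<in> carrier I" and "i \<in> carrier I \<Longrightarrow> \<bottom>\<^bsub>I\<^esub> \<sqsubseteq>\<^bsub>I\<^esub> i"
proof -
  have "least I (\<bottom>\<^bsub>I\<^esub>) (carrier I)"
    \<comment> \<open>The bottom is a mere choice of a least element; a constant symbol guarantees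
      through \<open>least_index\<close> that one exists.\<close>
    unfolding bottom_def using least_index assms by (metis someI_ex)
  then show "\<bottom>\<^bsub>I\<^esub> \<in> carrier I" "i \<in> carrier I \<Longrightarrow> \<bottom>\<^bsub>I\<^esub> \<sqsubseteq>\<^bsub>I\<^esub> i"
    by (auto simp: least_def)
qed

lemma Sup_bounds:
  assumes "finite J" "J \<subseteq> carrier I" "J \<noteq> {}"
  shows "\<Squnion>\<^bsub>I\<^esub>J \<in> carrier I" and "i \<in> J \<Longrightarrow> i \<sqsubseteq>\<^bsub>I\<^esub> \<Squnion>\<^bsub>I\<^esub>J"
    and "\<lbrakk>k \<in> carrier I; \<And>i. i \<in> J \<Longrightarrow> i \<sqsubseteq>\<^bsub>I\<^esub> k\<rbrakk> \<Longrightarrow> \<Squnion>\<^bsub>I\<^esub>J \<sqsubseteq>\<^bsub>I\<^esub> k"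
  using index.finite_sup_least[OF assms] assms(2) by (auto simp: least_def Upper_def)

text \<open>
  Constants occurring in the term contribute the least index, which is absorbed by any \<open>k\<close>.
\<close>

lemma eval_trm_P:
  assumes \<rho>: "\<And>v. \<rho> v \<in> carrier P" and k: "k \<in> carrier I"
  shows "\<lbrakk>wf_trm ar t; \<And>v. v \<in> vars_trm t \<Longrightarrow> ix (\<rho> v) \<sqsubseteq>\<^bsub>I\<^esub> k\<rbrakk> \<Longrightarrow>
    eval_trm P \<rho> t \<in> carrier P \<and> ix (eval_trm P \<rho> t) \<sqsubseteq>\<^bsub>I\<^esub> k \<and>
    (\<forall>v\<in>vars_trm t. ix (\<rho> v) \<sqsubseteq>\<^bsub>I\<^esub> ix (eval_trm P \<rho> t)) \<and>
    p (ix (eval_trm P \<rho> t)) k (eval_trm P \<rho> t) = eval_trm (A k) (\<lambda>v. p (ix (\<rho> v)) k (\<rho> v)) t"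
proof (induction t)
  case (Var x)
  then show ?case using \<rho> ix_mem by simp
next
  \<comment> \<open>One \<open>k\<close> serves all subterms, although they may contain different
    variables, so their images in \<open>A k\<close> can be arguments of a single operation.\<close>
  case (App g ts)
  let ?e = "eval_trm P \<rho>" and ?\<sigma> = "\<lambda>v. p (ix (\<rho> v)) k (\<rho> v)"
  have IH: "?e s \<in> carrier P" "ix (?e s) \<in> carrier I" "?e s \<in> carrier (A (ix (?e s)))"
    "ix (?e s) \<sqsubseteq>\<^bsub>I\<^esub> k"
    "\<And>v. v \<in> vars_trm s \<Longrightarrow> ix (\<rho> v) \<sqsubseteq>\<^bsub>I\<^esub> ix (?e s)"
    "p (ix (?e s)) k (?e s) = eval_trm (A k) ?\<sigma> s" if "s \<in> set ts" for s
  proof -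
    have "wf_trm ar s" "\<And>v. v \<in> vars_trm s \<Longrightarrow> ix (\<rho> v) \<sqsubseteq>\<^bsub>I\<^esub> k"
      using App.prems that by (auto simp: list_all_iff)
    note * = App.IH[OF that this]
    show "?e s \<in> carrier P" "ix (?e s) \<sqsubseteq>\<^bsub>I\<^esub> k"
      "\<And>v. v \<in> vars_trm s \<Longrightarrow> ix (\<rho> v) \<sqsubseteq>\<^bsub>I\<^esub> ix (?e s)"
      "p (ix (?e s)) k (?e s) = eval_trm (A k) ?\<sigma> s"
      using * by auto
    then show "ix (?e s) \<in> carrier I" "?e s \<in> carrier (A (ix (?e s)))"
      using ix_mem by auto
  qed
  have len: "length ts = ar g"
    using App.prems by simp
  show ?case
  proof (cases "ar g = 0")
    case True
    then have e: "?e (App g ts) = opn (A (\<bottom>\<^bsub>I\<^esub>)) g []" and ts: "ts = []"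
      using len by (simp_all add: plonka_sum_def)
    have mem: "?e (App g ts) \<in> carrier (A (\<bottom>\<^bsub>I\<^esub>))"
      unfolding e using True bottom_least(1) by (intro opn_closed) auto
    then have ix: "ix (?e (App g ts)) = \<bottom>\<^bsub>I\<^esub>"
      using bottom_least(1)[OF True] ix_eq by blast
    have "p (\<bottom>\<^bsub>I\<^esub>) k (?e (App g ts)) = eval_trm (A k) ?\<sigma> (App g ts)"
      unfolding e using bottom_least[OF True] k True by (simp add: ts p_opn)
    then show ?thesis
      using mem ix component_subset_P bottom_least[OF True] k ts by simp
  next
    case False
    \<comment> \<open>The component in which the sum evaluates \<open>g\<close>; moving on from
      there to \<open>k\<close> agrees with moving each argument to \<open>k\<close> directly, by
      \<open>hom_comp\<close>.\<close>
    define j where "j = \<Squnion>\<^bsub>I\<^esub>(ix ` set (map ?e ts))"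
    have J: "finite (ix ` set (map ?e ts))" "ix ` set (map ?e ts) \<subseteq> carrier I"
      "ix ` set (map ?e ts) \<noteq> {}"
      using IH(2) False len by auto
    have j: "j \<in> carrier I" "\<And>s. s \<in> set ts \<Longrightarrow> ix (?e s) \<sqsubseteq>\<^bsub>I\<^esub> j"
      unfolding j_def using Sup_bounds(1,2)[OF J] by auto
    have jk: "j \<sqsubseteq>\<^bsub>I\<^esub> k"
      unfolding j_def using IH(4) k by (intro Sup_bounds(3)[OF J]) auto
    let ?ys = "map (\<lambda>s. p (ix (?e s)) j (?e s)) ts"
    have e: "?e (App g ts) = opn (A j) g ?ys"
      using False by (simp add: plonka_sum_def Let_def j_def comp_def)
    have ys: "set ?ys \<subseteq> carrier (A j)"
      using IH j by (auto intro!: p_closed)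
    then have mem: "?e (App g ts) \<in> carrier (A j)"
      unfolding e using j len by (intro opn_closed) auto
    then have ix: "ix (?e (App g ts)) = j"
      using j ix_eq by blast
    have "p j k (?e (App g ts)) = opn (A k) g (map (p j k) ?ys)"
      unfolding e using j jk k len ys by (intro p_opn) auto
    also have "map (p j k) ?ys = map (eval_trm (A k) ?\<sigma>) ts"
      using IH j jk k by (auto simp: hom_comp[symmetric])
    finally have "p j k (?e (App g ts)) = eval_trm (A k) ?\<sigma> (App g ts)"
      by simp
    moreover have "ix (\<rho> v) \<sqsubseteq>\<^bsub>I\<^esub> j" if v: "v \<in> vars_trm (App g ts)" for v
    proof -
      obtain s where s: "s \<in> set ts" "v \<in> vars_trm s"
        using v by auto
      show ?thesis
        using index.le_trans[OF IH(5)[OF s] j(2)[OF s(1)]] \<rho> ix_mem IH(2)[OF s(1)] j(1) by blast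
    qed
    ultimately show ?thesis
      using mem ix component_subset_P j(1) jk by blast
  qed
qed

section \<open>Traces of a congruence on indices and on components\<close>

lemma C_rel_iff:
  "(i, j) \<in> C_rel I A \<theta> \<longleftrightarrow> i \<in> carrier I \<and> j \<in> carrier I \<and>
    (\<exists>a\<in>carrier (A i). \<exists>c\<in>carrier (A (i \<squnion>\<^bsub>I\<^esub> j)). (a, c) \<in> \<theta>) \<and>
    (\<exists>b\<in>carrier (A j). \<exists>c\<in>carrier (A (i \<squnion>\<^bsub>I\<^esub> j)). (b, c) \<in> \<theta>)"
  by (auto simp: C_rel_def S_rel_def component_def)

lemma is_congruence_component:
  assumes \<theta>: "is_congruence ar P \<theta>" and i: "i \<in> carrier I"
  shows "is_congruence ar (A i) (component A \<theta> i i)"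
proof -
  have eq: "equiv (carrier P) \<theta>"
    using \<theta> by (simp add: is_congruence_def)
  have "equiv (carrier (A i)) (component A \<theta> i i)"
    using eq i component_subset_P[OF i]
    by (auto simp: equiv_def component_def refl_on_def sym_def intro!: transI elim: transE)
  moreover have "(opn (A i) g xs, opn (A i) g ys) \<in> component A \<theta> i i"
    if len: "length xs = ar g" and rel: "list_all2 (\<lambda>x y. (x, y) \<in> component A \<theta> i i) xs ys" for g xs ys
  proof -
    have len': "length ys = ar g"
      using len rel list_all2_lengthD by fastforce
    have sub: "set xs \<subseteq> carrier (A i)" "set ys \<subseteq> carrier (A i)"
      using rel by (auto simp: list_all2_conv_all_nth component_def in_set_conv_nth)
    have mem: "opn (A i) g xs \<in> carrier (A i)" "opn (A i) g ys \<in> carrier (A i)"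
      using sub len len' i by (auto intro: opn_closed)
    show ?thesis
    \<comment> \<open>The sum interprets a constant in the least component only, so compatibility in
      the sum says nothing about the constant of \<open>A i\<close>; reflexivity settles this
      case.\<close>
    proof (cases "ar g = 0")
      case True
      then have "xs = ys"
        using len len' by simp
      then show ?thesis
        using mem component_subset_P[OF i] eq by (auto simp: component_def equiv_def refl_on_def)
    next
      case False
      \<comment> \<open>For arguments all in \<open>A i\<close> the join of the indices is
        \<open>i\<close>, and \<open>p i i\<close> is the identity there.\<close>
      have opn: "opn P g zs = opn (A i) g zs" if zs: "set zs \<subseteq> carrier (A i)" "length zs = ar g" for zs
      proof -
        have ix: "\<And>z. z \<in> set zs \<Longrightarrow> ix z = i"
          using zs i ix_eq by blast
        then have "ix ` set zs = {i}"
          using False zs by (cases zs) auto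
        moreover have "map (\<lambda>a. p (ix a) i a) zs = zs"
          using zs ix i by (intro map_idI) (auto simp: hom_id)
        ultimately show ?thesis
          using False i by (simp add: plonka_sum_def Sup_singleton)
      qed
      have "list_all2 (\<lambda>x y. (x, y) \<in> \<theta>) xs ys"
        using rel by (auto simp: component_def elim: list_all2_mono)
      then have "(opn P g xs, opn P g ys) \<in> \<theta>"
        using \<theta> len unfolding is_congruence_def by blast
      then show ?thesis
        using mem opn[OF sub(1) len] opn[OF sub(2) len'] by (simp add: component_def)
    qed
  qed
  ultimately show ?thesis
    by (simp add: is_congruence_def)
qed

end

section \<open>Congruences of the sum under strong irregularity\<close>

text \<open>The identity is demanded of the components only: in the sum, \<open>t\<close> has to
  remember the index of its second argument, and this is what will be exploited.\<close>

locale strongly_irregular_system = semilattice_direct_system ar I A p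
  for ar :: "'f \<Rightarrow> nat" and I :: "'i gorder" and A :: "'i \<Rightarrow> ('a, 'f) algebra" and p +
  fixes t :: "('f, nat) trm"
  assumes t_wf: "wf_trm ar t" and t_vars: "vars_trm t = {0, 1}"
    and t_fst: "i \<in> carrier I \<Longrightarrow> satisfies (A i) (t, Var 0)"
begin

text \<open>Since both variables occur in \<open>t\<close>, the index of the value lies above both
  indices, and \<open>eval_trm_P\<close> bounds it by their join \<open>k\<close>. Inside
  \<open>A k\<close> the identity then returns the image of \<open>a\<close>.\<close>

lemma eval_t:
  assumes a: "a \<in> carrier P" and b: "b \<in> carrier P"
  shows "eval_trm P (\<lambda>v. if v = 0 then a else b) t = act (ix b) a"
proof -
  define k where "k = ix a \<squnion>\<^bsub>I\<^esub> ix b"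
  let ?\<rho> = "\<lambda>v :: nat. if v = 0 then a else b"
  let ?e = "eval_trm P ?\<rho> t"
  have mem: "ix a \<in> carrier I" "ix b \<in> carrier I" "a \<in> carrier (A (ix a))" "b \<in> carrier (A (ix b))"
    using a b ix_mem by auto
  then have k: "k \<in> carrier I" "ix a \<sqsubseteq>\<^bsub>I\<^esub> k" "ix b \<sqsubseteq>\<^bsub>I\<^esub> k"
    by (auto simp: k_def index.join_left index.join_right)
  have e: "?e \<in> carrier P" "ix ?e \<sqsubseteq>\<^bsub>I\<^esub> k" "\<forall>v\<in>vars_trm t. ix (?\<rho> v) \<sqsubseteq>\<^bsub>I\<^esub> ix ?e"
    "p (ix ?e) k ?e = eval_trm (A k) (\<lambda>v. p (ix (?\<rho> v)) k (?\<rho> v)) t"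
    using eval_trm_P[of ?\<rho> k t] a b k t_wf by (auto simp: k(2,3))
  have "k \<sqsubseteq>\<^bsub>I\<^esub> ix ?e"
    using e(1,3) mem ix_mem unfolding k_def t_vars by (intro index.join_le) auto
  then have ix: "ix ?e = k"
    using e(1,2) k(1) ix_mem index.le_antisym by blast
  have "range (\<lambda>v. p (ix (?\<rho> v)) k (?\<rho> v)) \<subseteq> carrier (A k)"
    using mem k by (auto intro!: p_closed)
  then have "p (ix ?e) k ?e = p (ix a) k a"
    using e(4) t_fst[OF k(1)] by (simp add: satisfies_def)
  moreover have "p (ix ?e) k ?e = ?e"
    using ix ix_mem[OF e(1)] hom_id by simp
  ultimately show ?thesis
    by (simp add: act_def k_def)
qed

context
  fixes \<theta> :: "'a rel"
  assumes \<theta>: "is_congruence ar P \<theta>"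
begin

lemma congruence_equiv: "equiv (carrier P) \<theta>"
  using \<theta> by (simp add: is_congruence_def)

lemma congruence_mem: "(a, b) \<in> \<theta> \<Longrightarrow> a \<in> carrier P \<and> b \<in> carrier P"
  using congruence_equiv by (auto simp: equiv_def)

lemma congruence_refl: "a \<in> carrier P \<Longrightarrow> (a, a) \<in> \<theta>"
  using congruence_equiv by (auto simp: equiv_def refl_on_def)

lemma congruence_sym: "(a, b) \<in> \<theta> \<Longrightarrow> (b, a) \<in> \<theta>"
  using congruence_equiv by (auto simp: equiv_def sym_def)

lemma congruence_trans: "(a, b) \<in> \<theta> \<Longrightarrow> (b, c) \<in> \<theta> \<Longrightarrow> (a, c) \<in> \<theta>"
  using congruence_equiv by (auto simp: equiv_def trans_def)

text \<open>By \<open>eval_t\<close> this is compatibility of \<open>\<theta>\<close> with a binary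
  term operation. It permits replacing the acting index as well as the element acted on.\<close>

lemma congruence_act_ix:
  assumes "(a, a') \<in> \<theta>" "(b, b') \<in> \<theta>"
  shows "(act (ix b) a, act (ix b') a') \<in> \<theta>"
proof -
  have "(eval_trm P (\<lambda>v. if v = 0 then a else b) t, eval_trm P (\<lambda>v. if v = 0 then a' else b') t) \<in> \<theta>"
    using assms by (intro eval_trm_cong_congruence[OF \<theta> _ t_wf]) auto
  then show ?thesis
    using assms congruence_mem by (simp add: eval_t)
qed

lemma congruence_act:
  assumes "(a, b) \<in> \<theta>" "i \<in> carrier I"
  shows "(act i a, act i b) \<in> \<theta>"
proof -
  \<comment> \<open>Any element of \<open>A i\<close>, paired with itself, represents the fixed
    index \<open>i\<close>.\<close>
  obtain c where c: "c \<in> carrier (A i)"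
    using component_nonempty assms(2) by blast
  then have "(c, c) \<in> \<theta>" "ix c = i"
    using assms(2) component_subset_P congruence_refl ix_eq by auto
  then show ?thesis
    using congruence_act_ix[OF assms(1)] by metis
qed

text \<open>Pairs of \<open>\<theta>\<close> linking \<open>A i\<close> and \<open>A j\<close> to
  the component of the join allow \<open>i\<close> and \<open>j\<close> to be traded for that join
  in every action. Conversely, the actions on elements of \<open>A i\<close> and \<open>A j\<close>
  produce such pairs.\<close>

lemma C_rel_iff_act:
  "(i, j) \<in> C_rel I A \<theta> \<longleftrightarrow>
    i \<in> carrier I \<and> j \<in> carrier I \<and> (\<forall>a\<in>carrier P. (act i a, act j a) \<in> \<theta>)"
proof (cases "i \<in> carrier I \<and> j \<in> carrier I")
  case True
  then have i: "i \<in> carrier I" and j: "j \<in> carrier I" and ij: "i \<squnion>\<^bsub>I\<^esub> j \<in> carrier I"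
    by auto
  show ?thesis
  proof
    assume "(i, j) \<in> C_rel I A \<theta>"
    then obtain x y c d where "(x, c) \<in> \<theta>" "(y, d) \<in> \<theta>" "ix x = i" "ix y = j"
      "ix c = i \<squnion>\<^bsub>I\<^esub> j" "ix d = i \<squnion>\<^bsub>I\<^esub> j"
      using ix_eq i j ij unfolding C_rel_iff by blast
    then have "(act i a, act (i \<squnion>\<^bsub>I\<^esub> j) a) \<in> \<theta>" "(act j a, act (i \<squnion>\<^bsub>I\<^esub> j) a) \<in> \<theta>"
      if "a \<in> carrier P" for a
      using congruence_act_ix congruence_refl that by metis+
    then show "i \<in> carrier I \<and> j \<in> carrier I \<and> (\<forall>a\<in>carrier P. (act i a, act j a) \<in> \<theta>)"
      using i j congruence_sym congruence_trans by blast
  next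
    assume act: "i \<in> carrier I \<and> j \<in> carrier I \<and> (\<forall>a\<in>carrier P. (act i a, act j a) \<in> \<theta>)"
    obtain a b where a: "a \<in> carrier (A i)" and b: "b \<in> carrier (A j)"
      using i j component_nonempty by blast
    have P: "a \<in> carrier P" "b \<in> carrier P" and ix: "ix a = i" "ix b = j"
      using a b i j component_subset_P ix_eq by auto
    \<comment> \<open>Here \<open>i\<close> fixes \<open>a\<close> and \<open>j\<close> fixes
      \<open>b\<close>, by \<open>act_ix\<close>.\<close>
    have "(a, act j a) \<in> \<theta>" "(b, act i b) \<in> \<theta>"
      using act P ix act_ix congruence_sym by metis+
    moreover have "act j a \<in> carrier (A (i \<squnion>\<^bsub>I\<^esub> j))" "act i b \<in> carrier (A (i \<squnion>\<^bsub>I\<^esub> j))"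
      using act_mem_component[OF j P(1)] act_mem_component[OF i P(2)] ix join_comm[of I i j] by simp_all
    ultimately show "(i, j) \<in> C_rel I A \<theta>"
      unfolding C_rel_iff using i j a b by blast
  qed
qed (auto simp: C_rel_iff)

text \<open>Letting the indices of \<open>a\<close> and \<open>b\<close> act on one and the same
  element gives related results. This projects paths in the sum to paths in
  \<open>I\<close>.\<close>

lemma congruence_ix:
  assumes "(a, b) \<in> \<theta>"
  shows "(ix a, ix b) \<in> C_rel I A \<theta>"
  using congruence_act_ix[OF congruence_refl assms] congruence_mem[OF assms] ix_mem
  by (simp add: C_rel_iff_act)

lemma is_congruence_C_rel: "is_congruence semilattice_arity (semilattice_algebra I) (C_rel I A \<theta>)"
proof -
  have "equiv (carrier I) (C_rel I A \<theta>)"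
  proof (rule equivI)
    show "refl_on (carrier I) (C_rel I A \<theta>)"
      by (auto simp: refl_on_def C_rel_iff_act intro: congruence_refl act_closed)
    show "sym (C_rel I A \<theta>)"
      by (auto simp: sym_def C_rel_iff_act intro: congruence_sym)
    show "trans (C_rel I A \<theta>)"
      by (auto simp: trans_def C_rel_iff_act intro: congruence_trans)
  qed (auto simp: C_rel_iff)
  moreover have "(i \<squnion>\<^bsub>I\<^esub> k, j \<squnion>\<^bsub>I\<^esub> l) \<in> C_rel I A \<theta>"
    if "(i, j) \<in> C_rel I A \<theta>" "(k, l) \<in> C_rel I A \<theta>" for i j k l
  proof -
    have mem: "i \<in> carrier I" "j \<in> carrier I" "k \<in> carrier I" "l \<in> carrier I"
      using that by (auto simp: C_rel_iff)
    have "(act (i \<squnion>\<^bsub>I\<^esub> k) a, act (j \<squnion>\<^bsub>I\<^esub> l) a) \<in> \<theta>" if a: "a \<in> carrier P" for a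
    proof -
      \<comment> \<open>First \<open>i\<close> is exchanged for \<open>j\<close> underneath
        \<open>k\<close>, then \<open>k\<close> for \<open>l\<close> on the element
        \<open>act j a\<close>; \<open>act_act\<close> turns the ends into actions of the
        joins.\<close>
      have "(act k (act i a), act k (act j a)) \<in> \<theta>" "(act k (act j a), act l (act j a)) \<in> \<theta>"
        using \<open>(i, j) \<in> C_rel I A \<theta>\<close> \<open>(k, l) \<in> C_rel I A \<theta>\<close> a mem
        by (auto simp: C_rel_iff_act intro: congruence_act act_closed)
      then show ?thesis
        using congruence_trans a mem by (simp add: act_act)
    qed
    then show ?thesis
      using mem by (simp add: C_rel_iff_act)
  qed
  ultimately show ?thesis
    by (auto simp: is_congruence_def semilattice_algebra_def semilattice_arity_def
        list_all2_conv_all_nth)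
qed

end

section \<open>Factor congruences of the sum, its indices and its components\<close>

lemma factor_congruences_P_iff:
  assumes \<theta>1: "is_congruence ar P \<theta>1" and \<theta>2: "is_congruence ar P \<theta>2"
  shows "factor_congruences ar P \<theta>1 \<theta>2 \<longleftrightarrow>
    permutable \<theta>1 \<theta>2 \<and>
    factor_congruences semilattice_arity (semilattice_algebra I) (C_rel I A \<theta>1) (C_rel I A \<theta>2) \<and>
    (\<forall>i\<in>carrier I. factor_congruences ar (A i) (component A \<theta>1 i i) (component A \<theta>2 i i))"
    (is "?fac \<longleftrightarrow> ?perm \<and> ?fac_I \<and> ?fac_A")
proof
  assume ?fac
  then have int: "\<theta>1 \<inter> \<theta>2 = Id_on (carrier P)" and comp: "\<theta>1 O \<theta>2 = carrier P \<times> carrier P"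
    and perm: ?perm
    by (auto simp: factor_congruences_iff)
  have path: "\<exists>c\<in>carrier P. (a, c) \<in> \<theta>1 \<and> (c, b) \<in> \<theta>2" if "a \<in> carrier P" "b \<in> carrier P" for a b
    using comp that congruence_mem[OF \<theta>1] by blast
  have C_int: "i = j" if C: "(i, j) \<in> C_rel I A \<theta>1" "(i, j) \<in> C_rel I A \<theta>2" for i j
  proof -
    have ij: "i \<in> carrier I" "j \<in> carrier I"
      using C by (auto simp: C_rel_iff)
    have act: "act i a = act j a" if "a \<in> carrier P" for a
    proof -
      have "(act i a, act j a) \<in> \<theta>1 \<inter> \<theta>2"
        using C that by (simp add: C_rel_iff_act[OF \<theta>1] C_rel_iff_act[OF \<theta>2])
      then show ?thesis
        by (auto simp: int)
    qed
    obtain a b where "a \<in> carrier (A i)" "b \<in> carrier (A j)"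
      using ij component_nonempty by blast
    then have P: "a \<in> carrier P" "b \<in> carrier P" and ix: "ix a = i" "ix b = j"
      using ij component_subset_P ix_eq by auto
    \<comment> \<open>Compare indices in \<open>a = act i a = act j a\<close>, and likewise for
      \<open>b\<close>.\<close>
    have "i = i \<squnion>\<^bsub>I\<^esub> j" "j = j \<squnion>\<^bsub>I\<^esub> i"
      using act P ix ij ix_act act_ix by metis+
    then show "i = j"
      using join_comm by metis
  qed
  have ?fac_I
  proof (rule factor_congruencesI)
    fix i j assume "i \<in> carrier (semilattice_algebra I)" "j \<in> carrier (semilattice_algebra I)"
    then have ij: "i \<in> carrier I" "j \<in> carrier I"
      by (auto simp: semilattice_algebra_def)
    obtain a b where "a \<in> carrier (A i)" "b \<in> carrier (A j)"
      using ij component_nonempty by blast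
    then have "a \<in> carrier P" "b \<in> carrier P" and ix: "ix a = i" "ix b = j"
      using ij component_subset_P ix_eq by auto
    then obtain c where "(a, c) \<in> \<theta>1" "(c, b) \<in> \<theta>2"
      using path by blast
    then show "(i, j) \<in> C_rel I A \<theta>1 O C_rel I A \<theta>2"
      using congruence_ix[OF \<theta>1] congruence_ix[OF \<theta>2] ix by blast
  qed (use \<theta>1 \<theta>2 C_int is_congruence_C_rel in auto)
  moreover have ?fac_A
  proof
    fix i assume i: "i \<in> carrier I"
    show "factor_congruences ar (A i) (component A \<theta>1 i i) (component A \<theta>2 i i)"
    proof (rule factor_congruencesI)
      fix a b assume ab: "a \<in> carrier (A i)" "b \<in> carrier (A i)"
      then have P: "a \<in> carrier P" "b \<in> carrier P" and ix: "ix a = i" "ix b = i"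
        using i component_subset_P ix_eq by auto
      then obtain c where c: "c \<in> carrier P" "(a, c) \<in> \<theta>1" "(c, b) \<in> \<theta>2"
        using path by blast
      \<comment> \<open>\<open>c\<close> may lie outside \<open>A\<^sub>i\<close>, but \<open>act i c\<close> does not, since \<open>C\<^sub>\<theta>\<^sub>1 \<inter> C\<^sub>\<theta>\<^sub>2\<close> is trivial.\<close>
      have act: "(a, act i c) \<in> \<theta>1" "(act i c, b) \<in> \<theta>2"
        using congruence_act[OF \<theta>1 c(2) i] congruence_act[OF \<theta>2 c(3) i] act_ix P ix by metis+
      have "(i, ix (act i c)) \<in> C_rel I A \<theta>1" "(i, ix (act i c)) \<in> C_rel I A \<theta>2"
        using congruence_ix[OF \<theta>1 act(1)] congruence_ix[OF \<theta>2 congruence_sym[OF \<theta>2 act(2)]] ix by auto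
      then have "ix (act i c) = i"
        using C_int by metis
      then have "act i c \<in> carrier (A i)"
        using ix_mem[OF act_closed[OF i c(1)]] by simp
      then show "(a, b) \<in> component A \<theta>1 i i O component A \<theta>2 i i"
        using act ab by (auto simp: component_def)
    next
      show "a = b" if "(a, b) \<in> component A \<theta>1 i i" "(a, b) \<in> component A \<theta>2 i i" for a b
        using that IntI[of "(a, b)" \<theta>1 \<theta>2] by (auto simp: component_def int)
    qed (use \<theta>1 \<theta>2 i is_congruence_component in auto)
  qed
  ultimately show "?perm \<and> ?fac_I \<and> ?fac_A"
    using perm by blast
next
  assume "?perm \<and> ?fac_I \<and> ?fac_A"
  then have perm: "permutable \<theta>1 \<theta>2" and C_int: "C_rel I A \<theta>1 \<inter> C_rel I A \<theta>2 = Id_on (carrier I)"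
    and C_comp: "C_rel I A \<theta>1 O C_rel I A \<theta>2 = carrier I \<times> carrier I"
    and A_int: "\<And>i. i \<in> carrier I \<Longrightarrow>
      component A \<theta>1 i i \<inter> component A \<theta>2 i i = Id_on (carrier (A i))"
    and A_comp: "\<And>i. i \<in> carrier I \<Longrightarrow>
      component A \<theta>1 i i O component A \<theta>2 i i = carrier (A i) \<times> carrier (A i)"
    by (auto simp: factor_congruences_iff semilattice_algebra_def)
  \<comment> \<open>Permutability makes \<open>?R\<close> a congruence, so paths may be concatenated
    and reversed in it; what remains is to show that it is total.\<close>
  let ?R = "\<theta>1 O \<theta>2"
  have "is_congruence ar P ?R"
    using is_congruence_relcomp[OF \<theta>1 \<theta>2 perm] .
  note R = congruence_sym[OF this] congruence_trans[OF this]
  have act: "(a, act j a) \<in> ?R" if a: "a \<in> carrier P" and j: "j \<in> carrier I" for a j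
  proof -
    \<comment> \<open>A path from \<open>ix a\<close> to \<open>j\<close> in \<open>I\<close>,
      acting on \<open>a\<close>, becomes a path from \<open>a\<close> to \<open>act j a\<close> in
      the sum.\<close>
    obtain k where "(ix a, k) \<in> C_rel I A \<theta>1" "(k, j) \<in> C_rel I A \<theta>2"
      using C_comp ix_mem[OF a] j by blast
    then have "(act (ix a) a, act k a) \<in> \<theta>1" "(act k a, act j a) \<in> \<theta>2"
      using a by (auto simp: C_rel_iff_act[OF \<theta>1] C_rel_iff_act[OF \<theta>2])
    then show ?thesis
      using act_ix[OF a] by auto
  qed
  show ?fac
  proof (rule factor_congruencesI[OF \<theta>1 \<theta>2])
    fix a b assume ab: "(a, b) \<in> \<theta>1" "(a, b) \<in> \<theta>2"
    then have P: "a \<in> carrier P" "b \<in> carrier P"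
      using congruence_mem[OF \<theta>1] by auto
    have "(ix a, ix b) \<in> C_rel I A \<theta>1 \<inter> C_rel I A \<theta>2"
      using congruence_ix[OF \<theta>1 ab(1)] congruence_ix[OF \<theta>2 ab(2)] by (rule IntI)
    then have ix: "ix a = ix b"
      by (auto simp: C_int)
    have "(a, b) \<in> component A \<theta>1 (ix a) (ix a) \<inter> component A \<theta>2 (ix a) (ix a)"
      using ab ix_mem[OF P(1)] ix_mem[OF P(2)] by (simp add: component_def ix)
    then show "a = b"
      using A_int[of "ix a"] ix_mem[OF P(1)] by auto
  next
    fix a b assume a: "a \<in> carrier P" and b: "b \<in> carrier P"
    \<comment> \<open>Both elements are pushed into the common component \<open>A i\<close>, where
      the factor pair of \<open>A i\<close> connects their images.\<close>
    define i where "i = ix a \<squnion>\<^bsub>I\<^esub> ix b"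
    have mem: "ix a \<in> carrier I" "ix b \<in> carrier I" "i \<in> carrier I"
      using a b ix_mem by (auto simp: i_def)
    have "act (ix b) a \<in> carrier (A i)" "act (ix a) b \<in> carrier (A i)"
      using act_mem_component[OF mem(2) a] act_mem_component[OF mem(1) b]
        join_comm[of I "ix a" "ix b"] by (simp_all add: i_def)
    then have "(act (ix b) a, act (ix a) b) \<in> component A \<theta>1 i i O component A \<theta>2 i i"
      by (simp add: A_comp[OF mem(3)])
    then have mid: "(act (ix b) a, act (ix a) b) \<in> ?R"
      by (auto simp: component_def)
    show "(a, b) \<in> ?R"
      by (rule R(2)[OF R(2)[OF act[OF a mem(2)] mid] R(1)[OF act[OF b mem(1)]]])
  qed
qed

end

theorem theorem12:
  fixes ar :: "'f \<Rightarrow> nat"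
    and V :: "('a, 'f) algebra set"
    and I :: "'i gorder"
    and A :: "'i \<Rightarrow> ('a, 'f) algebra"
    and p :: "'i \<Rightarrow> 'i \<Rightarrow> 'a \<Rightarrow> 'a"
    and \<theta>1 \<theta>2 :: "'a rel"
  assumes "plural ar"
    and "variety ar V"
    and "strongly_irregular ar V"
    and "semilattice_direct_system ar I A p"
    and "\<And>i. i \<in> carrier I \<Longrightarrow> A i \<in> V"
    and "is_congruence ar (plonka_sum ar I A p) \<theta>1"
    and "is_congruence ar (plonka_sum ar I A p) \<theta>2"
  shows "factor_congruences ar (plonka_sum ar I A p) \<theta>1 \<theta>2 \<longleftrightarrow>
    permutable \<theta>1 \<theta>2 \<and>
    factor_congruences semilattice_arity (semilattice_algebra I) (C_rel I A \<theta>1) (C_rel I A \<theta>2) \<and>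
    (\<forall>i\<in>carrier I. factor_congruences ar (A i) (component A \<theta>1 i i) (component A \<theta>2 i i))"
proof -
  obtain t :: "('f, nat) trm" where t: "wf_trm ar t" "vars_trm t = {0, 1}"
    "\<forall>B\<in>V. satisfies B (t, Var 0)"
    using assms(3) unfolding strongly_irregular_def by blast
  interpret semilattice_direct_system ar I A p
    by (rule assms(4))
  interpret strongly_irregular_system ar I A p t
    using t assms(5) by unfold_locales auto
  show ?thesis
    using assms(6,7) by (rule factor_congruences_P_iff)
qed

end
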